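(* Let $\{p_m\}_{m\ge 0}$ be a real sequence with $p_0>0$ and $p_m\ge 0$ for all $m\ge 1$, such that the power series $p(y)=\sum_{m=0}^{\infty}p_m y^m$ has radius of convergence $R$ with $0<R\le\infty$. Let $\{\Re_m\}_{m\ge 0}$ be a sequence of positive linear operators from $C_{*}[0,\infty)$ into $B_{*}[0,\infty)$ such that $$\sum_{m=0}^{\infty}\left\Vert \Re_m\phi_0\right\Vert_\infty p_m y^m<\infty\quad\text{for every } 0<y<R .$$ If, for each $\nu=0,1,2$, $$\lim_{0<y\to R^-}\frac{1}{p(y)}\left\Vert \sum_{m=0}^{\infty}\left(\Re_m\phi_\nu-\phi_\nu\right)p_m y^m\right\Vert_\infty=0,$$ then for every $\phi\in C_{*}[0,\infty)$, $$\lim_{0<y\to R^-}\frac{1}{p(y)}\left\Vert \sum_{m=0}^{\infty}\left(\Re_m\phi-\phi\right)p_m y^m\right\Vert_\infty=0 .$$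
   Context: $C_{*}[0,\infty)$ is the space of continuous real-valued functions $\phi$ on $[0,\infty)$ for which $\lim_{\xi\to\infty}\phi(\xi)$ exists (and is finite). $B_{*}[0,\infty)$ is the space of bounded real-valued functions $\phi$ on $[0,\infty)$ (not necessarily continuous) for which $\lim_{\xi\to\infty}\phi(\xi)$ exists. Both carry the norm $\|\phi\|_\infty=\sup_{\xi\ge 0}|\phi(\xi)|$. A linear operator $\Re$ is positive if $\phi\ge 0$ implies $\Re\phi\ge 0$. The test functions are $\phi_\nu(t)=e^{-\nu t}$ for $\nu=0,1,2$ (so $\phi_0=1$). When $R=\infty$, $y\to R^-$ means $y\to\infty$. *)

theory Defs
  imports "HOL-Analysis.Analysis"
begin

text \<open>
  Functions on \<open>[0, \<infinity>)\<close> are represented by total functions of type \<^typ>\<open>real \<Rightarrow> real\<close> whose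
  values at negative arguments are irrelevant: membership in the spaces, the norm, positivity and
  linearity only refer to arguments in \<^term>\<open>{0::real..}\<close>.
\<close>

definition C_star :: "(real \<Rightarrow> real) set" where
  "C_star = {\<phi>. continuous_on {0..} \<phi> \<and> (\<exists>l. (\<phi> \<longlongrightarrow> l) at_top)}"

definition B_star :: "(real \<Rightarrow> real) set" where
  "B_star = {\<phi>. bounded (\<phi> ` {0..}) \<and> (\<exists>l. (\<phi> \<longlongrightarrow> l) at_top)}"

text \<open>The supremum is meaningful only for functions that are bounded on \<open>[0, \<infinity>)\<close>.\<close>

definition sup_norm :: "(real \<Rightarrow> real) \<Rightarrow> real" where
  "sup_norm \<phi> = (SUP \<xi>\<in>{0..}. \<bar>\<phi> \<xi>\<bar>)"

definition positive_linear_operator :: "((real \<Rightarrow> real) \<Rightarrow> (real \<Rightarrow> real)) \<Rightarrow> bool" where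
  "positive_linear_operator T \<longleftrightarrow>
     (\<forall>\<phi>\<in>C_star. T \<phi> \<in> B_star) \<and>
     (\<forall>\<phi>\<in>C_star. \<forall>\<psi>\<in>C_star. \<forall>\<xi>\<ge>0. T (\<lambda>t. \<phi> t + \<psi> t) \<xi> = T \<phi> \<xi> + T \<psi> \<xi>) \<and>
     (\<forall>c. \<forall>\<phi>\<in>C_star. \<forall>\<xi>\<ge>0. T (\<lambda>t. c * \<phi> t) \<xi> = c * T \<phi> \<xi>) \<and>
     (\<forall>\<phi>\<in>C_star. (\<forall>t\<ge>0. \<phi> t \<ge> 0) \<longrightarrow> (\<forall>\<xi>\<ge>0. T \<phi> \<xi> \<ge> 0))"

text \<open>
  Such an operator cannot see the values of its argument at negative points, so it really is an
  operator on functions on \<open>[0, \<infinity>)\<close>.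
\<close>

lemma positive_linear_operator_cong:
  assumes T: "positive_linear_operator T" and \<phi>: "\<phi> \<in> C_star" and \<psi>: "\<psi> \<in> C_star"
    and eq: "\<And>t. t \<ge> 0 \<Longrightarrow> \<phi> t = \<psi> t" and "\<xi> \<ge> 0"
  shows "T \<phi> \<xi> = T \<psi> \<xi>"
proof -
  have scale: "(\<lambda>t. - 1 * f t) \<in> C_star" if "f \<in> C_star" for f
    using that by (auto simp: C_star_def intro!: continuous_intros tendsto_minus exI)
  have add: "(\<lambda>t. f t + g t) \<in> C_star" if "f \<in> C_star" "g \<in> C_star" for f g
    using that by (auto simp: C_star_def intro!: continuous_intros tendsto_add exI)
  have le: "T g \<xi> \<le> T f \<xi>"
    if f: "f \<in> C_star" and g: "g \<in> C_star" and fg: "\<And>t. t \<ge> 0 \<Longrightarrow> f t = g t" for f g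
  proof -
    let ?h = "\<lambda>t. - 1 * g t"
    note T' = T[unfolded positive_linear_operator_def]
    note T_add = T'[THEN conjunct2, THEN conjunct1]
      and T_scale = T'[THEN conjunct2, THEN conjunct2, THEN conjunct1]
      and T_pos = T'[THEN conjunct2, THEN conjunct2, THEN conjunct2]
    have "\<forall>t\<ge>0. f t + ?h t \<ge> 0"
      using fg by simp
    then have "T (\<lambda>t. f t + ?h t) \<xi> \<ge> 0"
      using T_pos[THEN bspec, OF add[OF f scale[OF g]]] \<open>\<xi> \<ge> 0\<close> by simp
    moreover have "T (\<lambda>t. f t + ?h t) \<xi> = T f \<xi> + T ?h \<xi>"
      by (rule T_add[rule_format, OF f scale[OF g] \<open>\<xi> \<ge> 0\<close>])
    moreover have "T ?h \<xi> = - 1 * T g \<xi>"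
      by (rule T_scale[rule_format, OF g \<open>\<xi> \<ge> 0\<close>])
    ultimately show ?thesis by linarith
  qed
  show ?thesis
    using le[OF \<phi> \<psi>] le[OF \<psi> \<phi>] eq by force
qed

definition test_fun :: "nat \<Rightarrow> real \<Rightarrow> real" where
  "test_fun \<nu> t = exp (- real \<nu> * t)"

definition tends_to_radius :: "ereal \<Rightarrow> real filter" where
  "tends_to_radius R = (if R = \<infinity> then at_top else at_left (real_of_ereal R))"

end

theory Submission
  imports Defs
begin

text \<open>
  The substitution \<open>x = e\<^sup>-\<^sup>t\<close> turns a function in \<^const>\<open>C_star\<close> into a continuous function on
  \<open>[0, 1]\<close>. By uniform continuity, \<open>\<bar>\<phi> s - \<phi> \<xi>\<bar> \<le> \<epsilon> + K (e\<^sup>-\<^sup>s - e\<^sup>-\<^sup>\<xi>)\<^sup>2\<close>, where the square is a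
  combination of the three test functions in \<open>s\<close>. Applying the positive operators at \<open>\<xi>\<close> and
  summing against the weights \<open>p\<^sub>m y\<^sup>m\<close> bounds the error for \<open>\<phi>\<close> by \<open>\<epsilon>\<close> plus a fixed combination
  of the errors for the test functions, uniformly in \<open>\<xi>\<close>.
\<close>

section \<open>Functions with a limit at infinity and the substitution
  \<open>x = exp (- t)\<close>\<close>

lemma C_star_lincomb:
  assumes "f \<in> C_star" "g \<in> C_star"
  shows "(\<lambda>t. a * f t + b * g t) \<in> C_star"
proof -
  obtain k l where "(f \<longlongrightarrow> k) at_top" "(g \<longlongrightarrow> l) at_top"
    using assms by (auto simp: C_star_def)
  then have "((\<lambda>t. a * f t + b * g t) \<longlongrightarrow> a * k + b * l) at_top"
    by (intro tendsto_intros)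
  moreover have "continuous_on {0..} (\<lambda>t. a * f t + b * g t)"
    using assms by (auto simp: C_star_def intro!: continuous_intros)
  ultimately show ?thesis
    by (auto simp: C_star_def)
qed

lemma test_fun_in_C_star: "test_fun \<nu> \<in> C_star"
proof (cases "\<nu> = 0")
  case True
  then show ?thesis
    by (auto simp: C_star_def test_fun_def[abs_def])
next
  case False
  then have "(test_fun \<nu> \<longlongrightarrow> 0) at_top"
    unfolding test_fun_def
    by (intro filterlim_compose[OF exp_at_bot] filterlim_tendsto_neg_mult_at_bot[OF tendsto_const])
       (auto intro: filterlim_ident)
  moreover have "continuous_on {0..} (test_fun \<nu>)"
    unfolding test_fun_def by (intro continuous_intros)
  ultimately show ?thesis
    by (auto simp: C_star_def)
qed

text \<open>As \<open>t\<close> runs through \<open>{0..}\<close>, \<open>exp (- t)\<close> fills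
  \<open>{0<..1}\<close>. The missing endpoint 0 corresponds to infinity, where the limit of
  \<open>\<phi>\<close> provides the value of a continuous extension. This makes compactness of
  \<open>{0..1}\<close> available.\<close>

lemma C_star_exp_substitution:
  assumes "\<phi> \<in> C_star"
  obtains g :: "real \<Rightarrow> real"
  where "continuous_on {0..1} g" "\<And>t. t \<ge> 0 \<Longrightarrow> g (exp (- t)) = \<phi> t"
proof -
  from assms obtain l where l: "(\<phi> \<longlongrightarrow> l) at_top" and c: "continuous_on {0..} \<phi>"
    by (auto simp: C_star_def)
  \<comment> \<open>Only the value at \<open>x = 0\<close> matters in the first branch; it is the
    limit at infinity.\<close>
  define g where "g = (\<lambda>x::real. if x \<le> 0 then l else \<phi> (- ln x))"
  have lim0: "(g \<longlongrightarrow> l) (at_right 0)"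
  proof (rule Lim_transform_eventually)
    show "((\<lambda>x. \<phi> (- ln x)) \<longlongrightarrow> l) (at_right 0)"
      by (rule filterlim_compose[OF l filterlim_compose[OF filterlim_uminus_at_top_at_bot ln_at_0]])
    show "\<forall>\<^sub>F x in at_right 0. \<phi> (- ln x) = g x"
      unfolding eventually_at_right_field by (auto simp: g_def intro!: exI[of _ 1])
  qed
  have pos: "continuous_on {0<..1} (\<lambda>x::real. \<phi> (- ln x))"
    by (rule continuous_on_compose2[OF c]) (auto intro!: continuous_intros)
  have "continuous (at x within {0..1}) g" if "x \<in> {0..1}" for x
  proof (cases "x = 0")
    case True
    have "at (0::real) within {0..1} = at_right 0"
      by (simp add: at_within_Icc_at_right)
    with True show ?thesis
      using lim0 by (simp add: continuous_within g_def)
  next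
    case False
    with that have x: "x \<in> {0<..1}" by auto
    have "continuous_on {0<..1} g"
      using pos by (rule continuous_on_eq) (auto simp: g_def)
    then have "continuous (at x within {0<..1}) g"
      using x by (auto simp: continuous_on_eq_continuous_within)
    \<comment> \<open>The two intervals differ only in the point 0, which a positive
      \<open>x\<close> does not see locally.\<close>
    moreover have "at x within {0<..1} = at x within {0..1}"
      using x by (intro at_within_nhd[of _ "{0<..}"]) auto
    ultimately show ?thesis
      by simp
  qed
  then have "continuous_on {0..1} g"
    by (auto simp: continuous_on_eq_continuous_within)
  moreover have "g (exp (- t)) = \<phi> t" if "t \<ge> 0" for t
    by (simp add: g_def not_le)
  ultimately show thesis
    using that by blast
qed

lemma C_star_bounded:
  assumes "\<phi> \<in> C_star"
  obtains M where "M \<ge> 0" "\<And>t. t \<ge> 0 \<Longrightarrow> \<bar>\<phi> t\<bar> \<le> M"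
proof -
  obtain g where g: "continuous_on {0..1} g" "\<And>t. t \<ge> 0 \<Longrightarrow> g (exp (- t)) = \<phi> t"
    using C_star_exp_substitution[OF assms] by blast
  have "bounded (g ` {0..1})"
    by (intro compact_imp_bounded compact_continuous_image g(1)) auto
  then obtain M where M: "\<And>x. x \<in> {0..1} \<Longrightarrow> \<bar>g x\<bar> \<le> M"
    unfolding bounded_iff by fastforce
  have "\<bar>\<phi> t\<bar> \<le> M" if "t \<ge> 0" for t
    using M[of "exp (- t)"] g(2)[OF that] that by simp
  moreover from this[of 0] have "M \<ge> 0" by simp
  ultimately show thesis
    using that by blast
qed

text \<open>Two cases in the distance of \<open>exp (- s)\<close> and \<open>exp (- t)\<close>. If
  it is below the \<open>d\<close> of uniform continuity, \<open>\<epsilon>\<close> alone suffices.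
  Otherwise the square is at least \<open>d\<^sup>2\<close>, and the trivial bound
  \<open>2 * M\<close> on the difference is absorbed by the quadratic term.\<close>

lemma C_star_quadratic_modulus:
  assumes \<phi>: "\<phi> \<in> C_star" and "\<epsilon> > 0"
  obtains K where "K \<ge> 0"
    "\<And>s t. s \<ge> 0 \<Longrightarrow> t \<ge> 0 \<Longrightarrow> \<bar>\<phi> s - \<phi> t\<bar> \<le> \<epsilon> + K * (exp (- s) - exp (- t))\<^sup>2"
proof -
  obtain g where g: "continuous_on {0..1} g" "\<And>t. t \<ge> 0 \<Longrightarrow> g (exp (- t)) = \<phi> t"
    using C_star_exp_substitution[OF \<phi>] by blast
  obtain M where M: "M \<ge> 0" "\<And>t. t \<ge> 0 \<Longrightarrow> \<bar>\<phi> t\<bar> \<le> M"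
    using C_star_bounded[OF \<phi>] by blast
  have "uniformly_continuous_on {0..1} g"
    by (intro compact_uniformly_continuous g(1)) auto
  then obtain d where d: "d > 0"
    "\<And>x y. x \<in> {0..1} \<Longrightarrow> y \<in> {0..1} \<Longrightarrow> dist y x < d \<Longrightarrow> dist (g y) (g x) < \<epsilon>"
    using \<open>\<epsilon> > 0\<close> unfolding uniformly_continuous_on_def by metis
  \<comment> \<open>Chosen so that \<open>K * d\<^sup>2 = 2 * M\<close>.\<close>
  define K where "K = 2 * M / d\<^sup>2"
  have K: "K \<ge> 0"
    using M(1) by (simp add: K_def)
  have "\<bar>\<phi> s - \<phi> t\<bar> \<le> \<epsilon> + K * (exp (- s) - exp (- t))\<^sup>2" if st: "s \<ge> 0" "t \<ge> 0" for s t
  proof (cases "\<bar>exp (- s) - exp (- t)\<bar> < d")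
    case True
    then have "\<bar>\<phi> s - \<phi> t\<bar> < \<epsilon>"
      using d(2)[of "exp (- t)" "exp (- s)"] st g(2) by (simp add: dist_real_def)
    moreover have "K * (exp (- s) - exp (- t))\<^sup>2 \<ge> 0"
      using K by simp
    ultimately show ?thesis by linarith
  next
    case False
    then have "d\<^sup>2 \<le> (exp (- s) - exp (- t))\<^sup>2"
      using d(1) by (simp add: abs_le_square_iff[symmetric])
    then have "K * d\<^sup>2 \<le> K * (exp (- s) - exp (- t))\<^sup>2"
      using K by (rule mult_left_mono)
    moreover have "K * d\<^sup>2 = 2 * M"
      using d(1) by (simp add: K_def)
    ultimately show ?thesis
      using M(2)[OF st(1)] M(2)[OF st(2)] \<open>\<epsilon> > 0\<close> by linarith
  qed
  with K show thesis
    using that by blast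
qed

section \<open>Pointwise estimates for a single positive operator\<close>

lemma positive_linear_operator_lincomb:
  assumes T: "positive_linear_operator T" and f: "f \<in> C_star" and g: "g \<in> C_star" and "\<xi> \<ge> 0"
  shows "T (\<lambda>t. a * f t + b * g t) \<xi> = a * T f \<xi> + b * T g \<xi>"
proof -
  have mem: "(\<lambda>t. c * h t) \<in> C_star" if "h \<in> C_star" for c h
    using C_star_lincomb[OF that that, of c 0] by simp
  note T' = T[unfolded positive_linear_operator_def]
  note T_add = T'[THEN conjunct2, THEN conjunct1, rule_format]
    and T_scale = T'[THEN conjunct2, THEN conjunct2, THEN conjunct1, rule_format]
  show ?thesis
    by (simp only: T_add[OF mem[OF f] mem[OF g] \<open>\<xi> \<ge> 0\<close>] T_scale[OF f \<open>\<xi> \<ge> 0\<close>] T_scale[OF g \<open>\<xi> \<ge> 0\<close>])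
qed

lemma positive_linear_operator_mono:
  assumes T: "positive_linear_operator T" and f: "f \<in> C_star" and g: "g \<in> C_star" and "\<xi> \<ge> 0"
    and le: "\<And>t. t \<ge> 0 \<Longrightarrow> f t \<le> g t"
  shows "T f \<xi> \<le> T g \<xi>"
proof -
  have "T (\<lambda>t. 1 * g t + (-1) * f t) \<xi> \<ge> 0"
    using T C_star_lincomb[OF g f, of 1 "-1"] le \<open>\<xi> \<ge> 0\<close>
    unfolding positive_linear_operator_def by simp
  then show ?thesis
    using positive_linear_operator_lincomb[OF T g f \<open>\<xi> \<ge> 0\<close>, of 1 "-1"] by simp
qed

text \<open>\<open>test_fun 0\<close> is the constant 1, so \<open>f\<close> lies between the
  multiples \<open>- M\<close> and \<open>M\<close> of it, and monotonicity transfers both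
  bounds.\<close>

lemma positive_linear_operator_abs_le:
  assumes T: "positive_linear_operator T" and f: "f \<in> C_star" and "\<xi> \<ge> 0"
    and M: "\<And>t. t \<ge> 0 \<Longrightarrow> \<bar>f t\<bar> \<le> M"
  shows "\<bar>T f \<xi>\<bar> \<le> M * T (test_fun 0) \<xi>"
proof -
  note mem = test_fun_in_C_star[of 0]
  \<comment> \<open>The zero summand gives a scalar multiple the two-term shape of the linearity
    lemma.\<close>
  have const: "T (\<lambda>t. c * test_fun 0 t + 0 * test_fun 0 t) \<xi> = c * T (test_fun 0) \<xi>" for c
    using positive_linear_operator_lincomb[OF T mem mem \<open>\<xi> \<ge> 0\<close>, of c 0] by simp
  have "T f \<xi> \<le> M * T (test_fun 0) \<xi>"
    unfolding const[symmetric]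
    by (rule positive_linear_operator_mono[OF T f C_star_lincomb[OF mem mem] \<open>\<xi> \<ge> 0\<close>])
       (use M in \<open>force simp: test_fun_def abs_le_iff\<close>)
  moreover have "- M * T (test_fun 0) \<xi> \<le> T f \<xi>"
    unfolding const[symmetric]
    by (rule positive_linear_operator_mono[OF T C_star_lincomb[OF mem mem] f \<open>\<xi> \<ge> 0\<close>])
       (use M in \<open>force simp: test_fun_def abs_le_iff\<close>)
  ultimately show ?thesis by simp
qed

text \<open>With \<open>\<xi>\<close> fixed, the bound is a quadratic polynomial in
  \<open>exp (- s)\<close>, hence a combination of the three test functions. Monotonicity is applied
  to the resulting upper and lower bounds of \<open>\<phi>\<close>, and linearity evaluates
  \<open>T\<close> on them.\<close>

lemma positive_linear_operator_korovkin_le: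
  assumes T: "positive_linear_operator T" and \<phi>: "\<phi> \<in> C_star" and \<xi>: "\<xi> \<ge> 0"
    and le: "\<And>s. s \<ge> 0 \<Longrightarrow> \<bar>\<phi> s - \<phi> \<xi>\<bar> \<le> \<epsilon> + K * (exp (- s) - exp (- \<xi>))\<^sup>2"
  shows "\<bar>T \<phi> \<xi> - \<phi> \<xi> * T (test_fun 0) \<xi>\<bar> \<le>
    \<epsilon> * T (test_fun 0) \<xi> +
    K * (T (test_fun 2) \<xi> - 2 * exp (- \<xi>) * T (test_fun 1) \<xi> + (exp (- \<xi>))\<^sup>2 * T (test_fun 0) \<xi>)"
proof -
  define u where "u = exp (- \<xi>)"
  \<comment> \<open>The quadratic \<open>a + b * x + c * x\<^sup>2\<close> in
    \<open>x = exp (- t)\<close>; the factor 1 lets the two-term linearity lemma be applied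
    twice.\<close>
  define \<psi> where
    "\<psi> = (\<lambda>a b c t. 1 * (a * test_fun 0 t + b * test_fun 1 t) + c * test_fun 2 t)"
  note mem = C_star_lincomb[OF test_fun_in_C_star test_fun_in_C_star]
  have \<psi>_mem: "\<psi> a b c \<in> C_star" for a b c
    unfolding \<psi>_def by (rule C_star_lincomb[OF mem test_fun_in_C_star])
  have T\<psi>: "T (\<psi> a b c) \<xi> = a * T (test_fun 0) \<xi> + b * T (test_fun 1) \<xi> + c * T (test_fun 2) \<xi>"
    for a b c
    unfolding \<psi>_def
    by (simp add: positive_linear_operator_lincomb[OF T mem test_fun_in_C_star \<xi>, of 1, simplified]
        positive_linear_operator_lincomb[OF T test_fun_in_C_star test_fun_in_C_star \<xi>])
  have \<psi>_eq: "\<psi> a b c t = a + b * exp (- t) + c * (exp (- t))\<^sup>2" for a b c t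
    by (simp add: \<psi>_def test_fun_def power2_eq_square flip: exp_add)
  \<comment> \<open>The coefficients come from expanding
    \<open>\<phi> \<xi> + \<epsilon> + K * (x - u)\<^sup>2\<close>; those of the lower bound below
    come from \<open>\<phi> \<xi> - \<epsilon> - K * (x - u)\<^sup>2\<close>.\<close>
  have "T \<phi> \<xi> \<le> T (\<psi> (\<phi> \<xi> + \<epsilon> + K * u\<^sup>2) (- 2 * K * u) K) \<xi>"
  proof (rule positive_linear_operator_mono[OF T \<phi> \<psi>_mem \<xi>])
    fix t :: real assume "t \<ge> 0"
    from le[OF this] show "\<phi> t \<le> \<psi> (\<phi> \<xi> + \<epsilon> + K * u\<^sup>2) (- 2 * K * u) K t"
      unfolding \<psi>_eq u_def[symmetric] by (simp add: power2_eq_square algebra_simps abs_le_iff)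
  qed
  moreover have "T (\<psi> (\<phi> \<xi> - \<epsilon> - K * u\<^sup>2) (2 * K * u) (- K)) \<xi> \<le> T \<phi> \<xi>"
  proof (rule positive_linear_operator_mono[OF T \<psi>_mem \<phi> \<xi>])
    fix t :: real assume "t \<ge> 0"
    from le[OF this] show "\<psi> (\<phi> \<xi> - \<epsilon> - K * u\<^sup>2) (2 * K * u) (- K) t \<le> \<phi> t"
      unfolding \<psi>_eq u_def[symmetric] by (simp add: power2_eq_square algebra_simps abs_le_iff)
  qed
  ultimately show ?thesis
    unfolding T\<psi> u_def[symmetric] by (simp add: abs_le_iff algebra_simps)
qed

section \<open>The supremum norm and the filter of the limit\<close>

lemma abs_le_sup_norm:
  assumes "bdd_above ((\<lambda>\<xi>. \<bar>f \<xi>\<bar>) ` {0..})" and "\<xi> \<ge> 0"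
  shows "\<bar>f \<xi>\<bar> \<le> sup_norm f"
  unfolding sup_norm_def using assms by (intro cSUP_upper) auto

lemma sup_norm_le:
  assumes "\<And>\<xi>. \<xi> \<ge> 0 \<Longrightarrow> \<bar>f \<xi>\<bar> \<le> B"
  shows "sup_norm f \<le> B"
  unfolding sup_norm_def using assms by (intro cSUP_least) auto

lemma sup_norm_nonneg:
  assumes "bdd_above ((\<lambda>\<xi>. \<bar>f \<xi>\<bar>) ` {0..})"
  shows "sup_norm f \<ge> 0"
  using abs_le_sup_norm[OF assms, of 0] by simp

lemma eventually_tends_to_radius:
  assumes "R > 0"
  shows "\<forall>\<^sub>F y in tends_to_radius R. 0 < y \<and> ereal y < R"
proof (cases R)
  case (real r)
  with assms have "0 < r" by simp
  then have "\<forall>\<^sub>F y in at_left r. 0 < y \<and> y < r"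
    unfolding eventually_at_left_field by blast
  then show ?thesis
    using real by (simp add: tends_to_radius_def)
next
  case PInf
  then show ?thesis
    by (simp add: tends_to_radius_def eventually_gt_at_top)
qed (use assms in simp)

section \<open>Weighted sums of the operators at a fixed \<open>y\<close>\<close>

text \<open>
  \<open>w\<^sub>m\<close> stands for \<open>p\<^sub>m y\<^sup>m\<close> at a fixed \<open>y\<close>.
\<close>

locale weighted_operators =
  fixes w :: "nat \<Rightarrow> real" and T :: "nat \<Rightarrow> (real \<Rightarrow> real) \<Rightarrow> (real \<Rightarrow> real)"
  assumes w_nonneg: "w m \<ge> 0"
    and summable_w: "summable w"
    and T: "positive_linear_operator (T m)"
    and summable_norm: "summable (\<lambda>m. sup_norm (T m (test_fun 0)) * w m)"
begin

text \<open>For \<open>w m = p m * y ^ m\<close>, the quantity whose limit is sought is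
  \<open>sup_norm (err \<phi>) / suminf w\<close>.\<close>

definition err :: "(real \<Rightarrow> real) \<Rightarrow> real \<Rightarrow> real" where
  "err \<phi> \<xi> = (\<Sum>m. (T m \<phi> \<xi> - \<phi> \<xi>) * w m)"

text \<open>The bound is free of \<open>\<xi>\<close> and, multiplied by \<open>w m\<close>,
  summable by \<open>summable_norm\<close>. It therefore serves both as majorant for convergence and
  as uniform bound.\<close>

lemma abs_T_le:
  assumes "f \<in> C_star" "\<And>t. t \<ge> 0 \<Longrightarrow> \<bar>f t\<bar> \<le> M" "M \<ge> 0" "\<xi> \<ge> 0"
  shows "\<bar>T m f \<xi>\<bar> \<le> M * sup_norm (T m (test_fun 0))"
proof -
  have "T m (test_fun 0) \<in> B_star"
    using T[of m] test_fun_in_C_star unfolding positive_linear_operator_def by blast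
  then obtain B where "\<And>x. x \<in> {0..} \<Longrightarrow> \<bar>T m (test_fun 0) x\<bar> \<le> B"
    unfolding B_star_def bounded_iff by fastforce
  then have "bdd_above ((\<lambda>\<xi>. \<bar>T m (test_fun 0) \<xi>\<bar>) ` {0..})"
    by (intro bdd_aboveI2)
  then have "T m (test_fun 0) \<xi> \<le> sup_norm (T m (test_fun 0))"
    using abs_le_sup_norm \<open>\<xi> \<ge> 0\<close> by fastforce
  then have "M * T m (test_fun 0) \<xi> \<le> M * sup_norm (T m (test_fun 0))"
    using \<open>M \<ge> 0\<close> by (rule mult_left_mono)
  then show ?thesis
    using positive_linear_operator_abs_le[OF T assms(1) \<open>\<xi> \<ge> 0\<close> assms(2), of m] by simp
qed

lemma summable_T:
  assumes "f \<in> C_star" "\<xi> \<ge> 0"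
  shows "summable (\<lambda>m. T m f \<xi> * w m)"
proof -
  obtain M where M: "M \<ge> 0" "\<And>t. t \<ge> 0 \<Longrightarrow> \<bar>f t\<bar> \<le> M"
    using C_star_bounded[OF assms(1)] by blast
  show ?thesis
  proof (rule summable_comparison_test')
    show "summable (\<lambda>m. M * (sup_norm (T m (test_fun 0)) * w m))"
      using summable_norm by (rule summable_mult)
    show "norm (T m f \<xi> * w m) \<le> M * (sup_norm (T m (test_fun 0)) * w m)" for m
      using mult_right_mono[OF abs_T_le[OF assms(1) M(2,1) assms(2), of m] w_nonneg[of m]]
      by (simp add: abs_mult w_nonneg mult.assoc)
  qed
qed

lemma err_eq:
  assumes "f \<in> C_star" "\<xi> \<ge> 0"
  shows "err f \<xi> = (\<Sum>m. T m f \<xi> * w m) - f \<xi> * suminf w"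
  using suminf_diff[OF summable_T[OF assms] summable_mult[OF summable_w, of "f \<xi>"]]
  by (simp add: err_def left_diff_distrib suminf_mult[OF summable_w])

text \<open>Without this bound \<open>sup_norm\<close> of the error would not dominate its values.
  Summing \<open>abs_T_le\<close> against the weights bounds the operator part, and boundedness of
  \<open>f\<close> handles the rest.\<close>

lemma bdd_above_err:
  assumes "f \<in> C_star"
  shows "bdd_above ((\<lambda>\<xi>. \<bar>err f \<xi>\<bar>) ` {0..})"
proof -
  obtain M where M: "M \<ge> 0" "\<And>t. t \<ge> 0 \<Longrightarrow> \<bar>f t\<bar> \<le> M"
    using C_star_bounded[OF assms] by blast
  have "\<bar>err f \<xi>\<bar> \<le> M * (\<Sum>m. sup_norm (T m (test_fun 0)) * w m) + M * suminf w"
    if "\<xi> \<in> {0..}" for \<xi>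
  proof -
    have \<xi>: "\<xi> \<ge> 0" using that by simp
    have "norm (\<Sum>m. T m f \<xi> * w m) \<le> (\<Sum>m. M * (sup_norm (T m (test_fun 0)) * w m))"
      using mult_right_mono[OF abs_T_le[OF assms M(2,1) \<xi>] w_nonneg]
      by (intro norm_suminf_le summable_mult summable_norm)
         (simp add: abs_mult w_nonneg mult.assoc)
    moreover have "\<bar>f \<xi> * suminf w\<bar> \<le> M * suminf w"
      using M(2)[OF \<xi>] suminf_nonneg[OF summable_w w_nonneg]
      by (simp add: abs_mult mult_right_mono)
    ultimately show ?thesis
      unfolding err_eq[OF assms \<xi>] by (simp add: suminf_mult[OF summable_norm])
  qed
  then show ?thesis
    by (intro bdd_aboveI2)
qed

text \<open>The single-operator estimate is summed against the weights, and each sum is rewritten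
  through the errors of the test functions. What remains free of errors is only
  \<open>\<epsilon> * suminf w\<close>.\<close>

lemma abs_err_le:
  assumes \<phi>: "\<phi> \<in> C_star" and \<xi>: "\<xi> \<ge> 0" and "\<epsilon> \<ge> 0" "K \<ge> 0"
    and M: "\<bar>\<phi> \<xi>\<bar> \<le> M"
    and le: "\<And>s. s \<ge> 0 \<Longrightarrow> \<bar>\<phi> s - \<phi> \<xi>\<bar> \<le> \<epsilon> + K * (exp (- s) - exp (- \<xi>))\<^sup>2"
  shows "\<bar>err \<phi> \<xi>\<bar> \<le> \<epsilon> * suminf w + (\<epsilon> + K + M) * \<bar>err (test_fun 0) \<xi>\<bar>
    + 2 * K * \<bar>err (test_fun 1) \<xi>\<bar> + K * \<bar>err (test_fun 2) \<xi>\<bar>"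
proof -
  define u where "u = exp (- \<xi>)"
  have u: "0 \<le> u" "u \<le> 1"
    using \<xi> by (auto simp: u_def)
  define S where "S = (\<lambda>f. \<Sum>m. T m f \<xi> * w m)"
  have sums: "(\<lambda>m. T m f \<xi> * w m) sums S f" if "f \<in> C_star" for f
    unfolding S_def using summable_T[OF that \<xi>] by (rule summable_sums)
  note t_sums = sums[OF test_fun_in_C_star]
  define W where "W = suminf w"
  define e where "e = (\<lambda>\<nu>. err (test_fun \<nu>) \<xi>)"
  \<comment> \<open>At \<open>\<xi>\<close> the three test functions take the values 1,
    \<open>u\<close> and \<open>u\<^sup>2\<close>.\<close>
  have S: "S (test_fun 0) = e 0 + W" "S (test_fun 1) = e 1 + u * W" "S (test_fun 2) = e 2 + u\<^sup>2 * W"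
    unfolding e_def S_def W_def err_eq[OF test_fun_in_C_star \<xi>]
    by (auto simp: test_fun_def u_def power2_eq_square simp flip: exp_add)
  \<comment> \<open>\<open>a\<close> and \<open>b\<close> are the two sides of
    \<open>positive_linear_operator_korovkin_le\<close> for the \<open>m\<close>-th operator, before
    taking the absolute value on the left, times \<open>w m\<close>.\<close>
  define a where "a = (\<lambda>m. (T m \<phi> \<xi> - \<phi> \<xi> * T m (test_fun 0) \<xi>) * w m)"
  define b where "b = (\<lambda>m. (\<epsilon> * T m (test_fun 0) \<xi> +
      K * (T m (test_fun 2) \<xi> - 2 * u * T m (test_fun 1) \<xi> + u\<^sup>2 * T m (test_fun 0) \<xi>)) * w m)"
  have a_sums: "a sums (S \<phi> - \<phi> \<xi> * S (test_fun 0))"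
    unfolding a_def using sums_diff[OF sums[OF \<phi>] sums_mult[OF t_sums[of 0], of "\<phi> \<xi>"]]
    by (simp add: algebra_simps)
  have b_sums: "b sums (\<epsilon> * S (test_fun 0) +
      K * (S (test_fun 2) - 2 * u * S (test_fun 1) + u\<^sup>2 * S (test_fun 0)))"
    unfolding b_def
    using sums_add[OF sums_mult[OF t_sums[of 0], of \<epsilon>] sums_mult[OF sums_add[OF
      sums_diff[OF t_sums[of 2] sums_mult[OF t_sums[of 1], of "2 * u"]]
      sums_mult[OF t_sums[of 0], of "u\<^sup>2"]], of K]]
    by (simp add: algebra_simps)
  have "norm (a m) \<le> b m" for m
    using mult_right_mono[OF positive_linear_operator_korovkin_le[OF T \<phi> \<xi> le, of m] w_nonneg[of m]]
    by (simp add: a_def b_def abs_mult w_nonneg u_def)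
  then have "norm (suminf a) \<le> suminf b"
    using b_sums by (intro norm_suminf_le) (auto dest: sums_summable)
  then have "\<bar>S \<phi> - \<phi> \<xi> * S (test_fun 0)\<bar> \<le> \<epsilon> * S (test_fun 0) +
      K * (S (test_fun 2) - 2 * u * S (test_fun 1) + u\<^sup>2 * S (test_fun 0))"
    using a_sums b_sums by (simp add: sums_iff)
  \<comment> \<open>The multiples of \<open>W\<close> in the bracket cancel, since
    \<open>u\<^sup>2 - 2 * u * u + u\<^sup>2 = 0\<close>: the square vanishes at
    \<open>s = \<xi>\<close>.\<close>
  also have "\<dots> = \<epsilon> * W + \<epsilon> * e 0 + K * (e 2 - 2 * u * e 1 + u\<^sup>2 * e 0)"
    unfolding S by (simp add: algebra_simps power2_eq_square)
  also have "\<dots> \<le> \<epsilon> * W + \<epsilon> * \<bar>e 0\<bar> + K * (\<bar>e 2\<bar> + 2 * \<bar>e 1\<bar> + \<bar>e 0\<bar>)"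
  proof -
    have "- (u * e 1) \<le> u * \<bar>e 1\<bar>"
      using mult_left_mono[OF abs_ge_minus_self[of "e 1"] u(1)] by simp
    also have "\<dots> \<le> \<bar>e 1\<bar>"
      using mult_right_mono[OF u(2), of "\<bar>e 1\<bar>"] by simp
    finally have 1: "- (u * e 1) \<le> \<bar>e 1\<bar>" .
    have "u\<^sup>2 * e 0 \<le> u\<^sup>2 * \<bar>e 0\<bar>"
      by (intro mult_left_mono) auto
    also have "\<dots> \<le> \<bar>e 0\<bar>"
      using mult_right_mono[of "u\<^sup>2" 1 "\<bar>e 0\<bar>"] u by (simp add: power_le_one)
    finally have 0: "u\<^sup>2 * e 0 \<le> \<bar>e 0\<bar>" .
    have "e 2 - 2 * u * e 1 + u\<^sup>2 * e 0 \<le> \<bar>e 2\<bar> + 2 * \<bar>e 1\<bar> + \<bar>e 0\<bar>"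
      using 0 1 by linarith
    then have "K * (e 2 - 2 * u * e 1 + u\<^sup>2 * e 0) \<le> K * (\<bar>e 2\<bar> + 2 * \<bar>e 1\<bar> + \<bar>e 0\<bar>)"
      using \<open>K \<ge> 0\<close> by (rule mult_left_mono)
    moreover have "\<epsilon> * e 0 \<le> \<epsilon> * \<bar>e 0\<bar>"
      using \<open>\<epsilon> \<ge> 0\<close> by (intro mult_left_mono) auto
    ultimately show ?thesis
      by linarith
  qed
  finally have "\<bar>S \<phi> - \<phi> \<xi> * S (test_fun 0)\<bar> \<le>
    \<epsilon> * W + \<epsilon> * \<bar>e 0\<bar> + K * (\<bar>e 2\<bar> + 2 * \<bar>e 1\<bar> + \<bar>e 0\<bar>)" .
  \<comment> \<open>The estimate so far compares with \<open>\<phi> \<xi> * S (test_fun 0)\<close>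
    rather than \<open>\<phi> \<xi> * W\<close>; the discrepancy is \<open>\<phi> \<xi>\<close>
    times the error of the constant 1.\<close>
  moreover have "err \<phi> \<xi> = (S \<phi> - \<phi> \<xi> * S (test_fun 0)) + \<phi> \<xi> * e 0"
    unfolding S(1) err_eq[OF \<phi> \<xi>] by (simp add: S_def W_def algebra_simps)
  moreover have "\<bar>\<phi> \<xi> * e 0\<bar> \<le> M * \<bar>e 0\<bar>"
    using M by (simp add: abs_mult mult_right_mono)
  ultimately have "\<bar>err \<phi> \<xi>\<bar> \<le>
    \<epsilon> * W + \<epsilon> * \<bar>e 0\<bar> + K * (\<bar>e 2\<bar> + 2 * \<bar>e 1\<bar> + \<bar>e 0\<bar>) + M * \<bar>e 0\<bar>"
    by linarith
  then show ?thesis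
    by (simp add: W_def e_def algebra_simps)
qed

lemma sup_norm_err_le:
  assumes \<phi>: "\<phi> \<in> C_star" and "\<epsilon> \<ge> 0" "K \<ge> 0"
    and M: "M \<ge> 0" "\<And>t. t \<ge> 0 \<Longrightarrow> \<bar>\<phi> t\<bar> \<le> M"
    and le: "\<And>s t. s \<ge> 0 \<Longrightarrow> t \<ge> 0 \<Longrightarrow> \<bar>\<phi> s - \<phi> t\<bar> \<le> \<epsilon> + K * (exp (- s) - exp (- t))\<^sup>2"
  shows "sup_norm (err \<phi>) \<le> \<epsilon> * suminf w + (\<epsilon> + K + M) * sup_norm (err (test_fun 0))
    + 2 * K * sup_norm (err (test_fun 1)) + K * sup_norm (err (test_fun 2))"
proof (rule sup_norm_le)
  fix \<xi> :: real assume \<xi>: "\<xi> \<ge> 0"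
  have "\<bar>err (test_fun \<nu>) \<xi>\<bar> \<le> sup_norm (err (test_fun \<nu>))" for \<nu>
    by (rule abs_le_sup_norm[OF bdd_above_err[OF test_fun_in_C_star] \<xi>])
  then have "\<epsilon> * suminf w + (\<epsilon> + K + M) * \<bar>err (test_fun 0) \<xi>\<bar>
    + 2 * K * \<bar>err (test_fun 1) \<xi>\<bar> + K * \<bar>err (test_fun 2) \<xi>\<bar> \<le>
    \<epsilon> * suminf w + (\<epsilon> + K + M) * sup_norm (err (test_fun 0))
    + 2 * K * sup_norm (err (test_fun 1)) + K * sup_norm (err (test_fun 2))"
    using assms(2,3) M(1) by (intro add_mono mult_left_mono) auto
  with abs_err_le[OF \<phi> \<xi> assms(2,3) M(2)[OF \<xi>] le[OF _ \<xi>]]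
  show "\<bar>err \<phi> \<xi>\<bar> \<le> \<epsilon> * suminf w + (\<epsilon> + K + M) * sup_norm (err (test_fun 0))
    + 2 * K * sup_norm (err (test_fun 1)) + K * sup_norm (err (test_fun 2))"
    by linarith
qed

end

section \<open>Passage to the limit at the radius of convergence\<close>

theorem theorem3:
  fixes p :: "nat \<Rightarrow> real"
    and R :: ereal
    and T :: "nat \<Rightarrow> (real \<Rightarrow> real) \<Rightarrow> (real \<Rightarrow> real)"
  assumes "p 0 > 0"
    and "\<And>m. m \<ge> 1 \<Longrightarrow> p m \<ge> 0"
    and "conv_radius p = R"
    and "R > 0"
    and "\<And>m. positive_linear_operator (T m)"
    and "\<And>y::real. 0 < y \<Longrightarrow> ereal y < R \<Longrightarrow>
           summable (\<lambda>m. sup_norm (T m (test_fun 0)) * p m * y ^ m)"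
    and "\<And>\<nu>. \<nu> \<in> {0, 1, 2} \<Longrightarrow>
           ((\<lambda>y. 1 / (\<Sum>m. p m * y ^ m) *
                 sup_norm (\<lambda>\<xi>. \<Sum>m. (T m (test_fun \<nu>) \<xi> - test_fun \<nu> \<xi>) * p m * y ^ m))
             \<longlongrightarrow> 0) (tends_to_radius R)"
  shows "\<forall>\<phi>\<in>C_star.
           ((\<lambda>y. 1 / (\<Sum>m. p m * y ^ m) *
                 sup_norm (\<lambda>\<xi>. \<Sum>m. (T m \<phi> \<xi> - \<phi> \<xi>) * p m * y ^ m))
             \<longlongrightarrow> 0) (tends_to_radius R)"
proof
  fix \<phi> :: "real \<Rightarrow> real" assume \<phi>: "\<phi> \<in> C_star"
  define n where "n = (\<lambda>f y. 1 / (\<Sum>m. p m * y ^ m) *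
                 sup_norm (\<lambda>\<xi>. \<Sum>m. (T m f \<xi> - f \<xi>) * p m * y ^ m))"
  have lim: "(n (test_fun \<nu>) \<longlongrightarrow> 0) (tends_to_radius R)" if "\<nu> \<in> {0, 1, 2}" for \<nu>
    unfolding n_def using assms(7)[OF that] .
  have p_nonneg: "p m \<ge> 0" for m
    using assms(1) assms(2)[of m] by (cases m) auto
  obtain M where M: "M \<ge> 0" "\<And>t. t \<ge> 0 \<Longrightarrow> \<bar>\<phi> t\<bar> \<le> M"
    using C_star_bounded[OF \<phi>] by blast
  have "(n \<phi> \<longlongrightarrow> 0) (tends_to_radius R)"
  proof (rule tendstoI)
    fix e :: real assume "e > 0"
    then have "e / 2 > 0" by simp
    from C_star_quadratic_modulus[OF \<phi> this] obtain K where K: "K \<ge> 0"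
      "\<And>s t. s \<ge> 0 \<Longrightarrow> t \<ge> 0 \<Longrightarrow> \<bar>\<phi> s - \<phi> t\<bar> \<le> e / 2 + K * (exp (- s) - exp (- t))\<^sup>2"
      by blast
    \<comment> \<open>The bound of \<open>sup_norm_err_le\<close> divided by
      \<open>suminf w\<close>, with \<open>e / 2\<close> as its \<open>\<epsilon>\<close>.
      \<open>K\<close> depends on \<open>e\<close> but not on \<open>y\<close>, so \<open>B\<close>
      tends to \<open>e / 2\<close> and is eventually below \<open>e\<close>.\<close>
    define B where "B = (\<lambda>y. e / 2 + (e / 2 + K + M) * n (test_fun 0) y
      + 2 * K * n (test_fun 1) y + K * n (test_fun 2) y)"
    have "(B \<longlongrightarrow> e / 2 + (e / 2 + K + M) * 0 + 2 * K * 0 + K * 0) (tends_to_radius R)"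
      unfolding B_def by (intro tendsto_intros lim) auto
    then have "\<forall>\<^sub>F y in tends_to_radius R. B y < e"
      by (rule order_tendstoD(2)) (use \<open>e > 0\<close> in simp)
    with eventually_tends_to_radius[OF assms(4)]
    show "\<forall>\<^sub>F y in tends_to_radius R. dist (n \<phi> y) 0 < e"
    proof eventually_elim
      case (elim y)
      then have y: "0 < y" "ereal y < R" by auto
      define w where "w = (\<lambda>m. p m * y ^ m)"
      have w: "summable w"
        unfolding w_def using y assms(3) by (intro summable_in_conv_radius) auto
      interpret weighted_operators w T
        by unfold_locales
          (use w assms(5) assms(6)[OF y] p_nonneg y(1) in \<open>auto simp: w_def mult.assoc\<close>)
      \<comment> \<open>The term of index 0 equals \<open>p 0\<close>, which is positive, and the
        others are nonnegative.\<close>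
      have pos: "suminf w > 0"
        by (rule suminf_pos2[OF w w_nonneg, of 0]) (simp add: w_def assms(1))
      have n_eq: "n f y = sup_norm (err f) / suminf w" for f
        unfolding n_def err_def[abs_def] unfolding w_def mult.assoc by simp
      have "e / 2 \<ge> 0" using \<open>e > 0\<close> by simp
      from sup_norm_err_le[OF \<phi> this K(1) M K(2)]
      have "n \<phi> y \<le> B y"
        unfolding n_eq B_def using pos by (simp add: field_simps)
      moreover have "n \<phi> y \<ge> 0"
        unfolding n_eq using sup_norm_nonneg[OF bdd_above_err[OF \<phi>]] pos by simp
      ultimately show ?case
        using elim by (simp add: dist_real_def)
    qed
  qed
  then show "((\<lambda>y. 1 / (\<Sum>m. p m * y ^ m) *
                 sup_norm (\<lambda>\<xi>. \<Sum>m. (T m \<phi> \<xi> - \<phi> \<xi>) * p m * y ^ m))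
             \<longlongrightarrow> 0) (tends_to_radius R)"
    by (simp add: n_def)
qed

end
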